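(* Consider the NoisyOR dynamic Bayesian network on a finite set of links $\mathcal{I}$ over time steps $1,\dots,T$ ($T\ge 2$) described in the context, with parameters $\boldsymbol{\theta}=(\mathbf{q},\boldsymbol{\mu},\boldsymbol{\sigma})$, where $\mathbf{q}=(q_{i,j})_{i\in\mathcal{I},\,0\le j\le|\pi_i|}$, $q_{i,j}\in[0,1]$, and $p_{i,j}=1-q_{i,j}$. Let $\mathbf{y}$ be the given observations, let $\boldsymbol{\theta}^{\ell}$ be the parameter estimate after the $\ell$-th EM iteration (with $\mathbf{y}$ having positive density under $\boldsymbol{\theta}^{\ell}$), and let $Q(\boldsymbol{\theta},\boldsymbol{\theta}^{\ell})$ be the expected complete-data log-likelihood. Then the transition parameters $\mathbf{q}^{\ell+1}$ produced by the M-step, i.e. obtained by maximizing $Q(\boldsymbol{\theta},\boldsymbol{\theta}^{\ell})$ over the transition parameters, are as follows. For every link $i\in\mathcal{I}$ and every $j\in\{1,\dots,|\pi_i|\}$, $$q_{i,j}^{\ell+1}\ \propto\ \sum_{t=2}^{T}P\big(\eta^{i,t-1}_j=1,\ \bar{\eta}^{i,t-1}_j=0\,\big|\,\mathbf{y},\boldsymbol{\theta}^{\ell}\big),$$ $$p_{i,j}^{\ell+1}\ \propto\ \sum_{t=2}^{T}P\big(\eta^{i,t-1}_j=1,\ \bar{\eta}^{i,t-1}_j=1\,\big|\,\mathbf{y},\boldsymbol{\theta}^{\ell}\big),$$ with the same proportionality constant in both expressions (determined by $q_{i,j}^{\ell+1}+p_{i,j}^{\ell+1}=1$, provided the two right-hand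 sides are not both zero). For every link $i\in\mathcal{I}$ and $j=0$, $$q_{i,0}^{\ell+1}\ \propto\ \sum_{t=1}^{T}P\big(\bar{\eta}^{i,t-1}_0=0\,\big|\,\mathbf{y},\boldsymbol{\theta}^{\ell}\big),\qquad p_{i,0}^{\ell+1}\ \propto\ \sum_{t=1}^{T}P\big(\bar{\eta}^{i,t-1}_0=1\,\big|\,\mathbf{y},\boldsymbol{\theta}^{\ell}\big),$$ again with the same proportionality constant in both expressions, determined by $q_{i,0}^{\ell+1}+p_{i,0}^{\ell+1}=1$.
   Context: **Hidden states.** $\mathcal{I}$ is a finite set of road links. For each $i\in\mathcal{I}$, $\pi_i\subseteq\mathcal{I}$ is the set of links adjacent to $i$, including $i$ itself, enumerated as neighbors $1,\dots,|\pi_i|$. For each link $i$ and time $t$, $s^{i,t}\in\{0,1\}$ is the hidden congestion state (1 = congested). All links are uncongested at time $0$: $s^{i,0}=0$. Let $\eta^{i,t}_j$ denote the state at time $t$ of the $j$-th neighbor of $i$ ($1\le j\le|\pi_i|$), so $\eta^{i,t}_j=s^{m,t}$ where $m$ is the $j$-th element of $\pi_i$; put $\boldsymbol{\eta}^{i,t}=(\eta^{i,t}_1,\dots,\eta^{i,t}_{|\pi_i|})$. **NoisyOR transitions.** For each $i$ and each $t\in\{1,\dots,T\}$ there are auxiliary hidden binary variables $\bar{\boldsymbol{\eta}}^{i,t-1}=(\bar\eta^{i,t-1}_0,\dots,\bar\eta^{i,t-1}_{|\pi_i|})$ which, given all the states at time $t-1$, are conditionally independent (over $j$ and over $i$, and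 of the earlier past), with - $P(\bar\eta^{i,t-1}_0=0)=q_{i,0}$ and $P(\bar\eta^{i,t-1}_0=1)=p_{i,0}=1-q_{i,0}$; - for $1\le j\le|\pi_i|$: if $\eta^{i,t-1}_j=0$ then $\bar\eta^{i,t-1}_j=0$; if $\eta^{i,t-1}_j=1$ then $\bar\eta^{i,t-1}_j=0$ with probability $q_{i,j}$ and $\bar\eta^{i,t-1}_j=1$ with probability $p_{i,j}=1-q_{i,j}$. The new state is the deterministic OR, $s^{i,t}=\mathrm{OR}(\bar{\boldsymbol{\eta}}^{i,t-1})$. Thus the transition factor is $$A(\boldsymbol{\eta}^{i,t-1},\bar{\boldsymbol{\eta}}^{i,t-1},s^{i,t})=q_{i,0}^{1-\bar\eta^{i,t-1}_0}\,p_{i,0}^{\bar\eta^{i,t-1}_0}\,\mathbf{1}\{\mathrm{OR}(\bar{\boldsymbol{\eta}}^{i,t-1})=s^{i,t}\}\prod_{j=1}^{|\pi_i|}q_{i,j}^{\eta^{i,t-1}_j(1-\bar\eta^{i,t-1}_j)}\,p_{i,j}^{\eta^{i,t-1}_j\bar\eta^{i,t-1}_j}$$ on configurations with $\bar\eta^{i,t-1}_j\le\eta^{i,t-1}_j$ for all $j\ge1$, and is $0$ otherwise. (At $t=1$, since all links are uncongested at time $0$, this reduces to $s^{i,1}=\bar\eta^{i,0}_0$, i.e. $P(s^{i,1}=0)=q_{i,0}$.) **Observations.** At each time $t\in\{1,\dots,T\}$ there are $N^v_t$ vehicles. Vehicle $k$ yields a travel-time observation $y^k_t\in\mathbb{R}$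 along a known sequence of links $L_t(k)$ with known start and end positions. Given the link states, link $i$ in state $s$ has travel time $\mathcal{N}(\mu^{i,s},(\sigma^{i,s})^2)$, $\sigma^{i,s}>0$, independently over links, and $y^k_t$ is the sum of the travel times over $L_t(k)$ (the first and last scaled by the fraction of the link traversed). Its conditional density $f(y^k_t\mid s^{L_t(k),t})$ is therefore Gaussian and depends only on $(\boldsymbol{\mu},\boldsymbol{\sigma})$ and on the states at time $t$ of the links in $L_t(k)$. Observations are conditionally independent given the hidden states, and $\mathbf{y}$ denotes all of them. **Complete-data likelihood and EM.** With $\mathbf{s}$ denoting all hidden variables (link states together with the auxiliary variables $\bar{\boldsymbol{\eta}}$), the complete-data likelihood is $$p(\mathbf{s},\mathbf{y}\mid\boldsymbol{\theta})=\prod_{t=1}^{T}\prod_{i\in\mathcal{I}}A(\boldsymbol{\eta}^{i,t-1},\bar{\boldsymbol{\eta}}^{i,t-1},s^{i,t})\ \prod_{t=1}^{T}\prod_{k=1}^{N^v_t}f(y^k_t\mid s^{L_t(k),t}).$$ The expected complete-data log-likelihood is $$Q(\boldsymbol{\theta},\boldsymbol{\theta}^{\ell})=\sum_{\mathbf{s}}p(\mathbf{s}\mid\mathbf{y},\boldsymbol{\theta}^{\ell})\,\ln p(\mathbf{y},\mathbf{s}\mid\boldsymbol{\theta}),$$ with the convention $0\ln 0=0$, and the M-step sets $\boldsymbol{\theta}^{\ell+1}=\arg\max_{\boldsymbol{\theta}}Q(\boldsymbol{\theta},\boldsymbol{\theta}^{\ell})$. $Q$ is a sum of a term depending only on $\mathbf{q}$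 and a term depending only on $(\boldsymbol{\mu},\boldsymbol{\sigma})$, so the transition update is the maximization over $\mathbf{q}$ (each $q_{i,j}\in[0,1]$) with $(\boldsymbol{\mu},\boldsymbol{\sigma})$ held at any fixed value. $P(\cdot\mid\mathbf{y},\boldsymbol{\theta}^{\ell})$ is the posterior law of the hidden variables given $\mathbf{y}$ under $\boldsymbol{\theta}^{\ell}$. *)

theory Defs
  imports "HOL-Probability.Probability"
begin

text \<open>
  A road network together with the observation layout. \<open>nbrs N i\<close> is the fixed enumeration of the
  links adjacent to \<open>i\<close> (including \<open>i\<close>); its \<open>j\<close>-th element in the 1-based numbering is
  \<open>nbrs N i ! (j - 1)\<close>. Vehicle \<open>k \<in> {1..num_veh N t}\<close> at time \<open>t\<close> traverses the links
  \<open>route N t k\<close>, from position \<open>start_pos N t k\<close> on the first to position \<open>end_pos N t k\<close>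
  on the last, positions being fractions of the link length.
\<close>

record 'i network =
  links :: "'i set"
  nbrs :: "'i \<Rightarrow> 'i list"
  horizon :: nat
  num_veh :: "nat \<Rightarrow> nat"
  route :: "nat \<Rightarrow> nat \<Rightarrow> 'i list"
  start_pos :: "nat \<Rightarrow> nat \<Rightarrow> real"
  end_pos :: "nat \<Rightarrow> nat \<Rightarrow> real"

abbreviation deg :: "'i network \<Rightarrow> 'i \<Rightarrow> nat" where
  "deg N i \<equiv> length (nbrs N i)"

definition frac_traversed :: "'i network \<Rightarrow> nat \<Rightarrow> nat \<Rightarrow> nat \<Rightarrow> real" where
  "frac_traversed N t k r =
     (let n = length (route N t k) in
      if n = 1 then end_pos N t k - start_pos N t k
      else if r = 0 then 1 - start_pos N t k
      else if r = n - 1 then end_pos N t k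
      else 1)"

text \<open>
  The last condition says that every vehicle travels a positive distance; otherwise its travel time
  would be deterministic and have no density.
\<close>

definition wf_network :: "'i network \<Rightarrow> bool" where
  "wf_network N \<longleftrightarrow>
     finite (links N) \<and>
     (\<forall>i\<in>links N. distinct (nbrs N i) \<and> set (nbrs N i) \<subseteq> links N \<and> i \<in> set (nbrs N i)) \<and>
     (\<forall>t\<in>{1..horizon N}. \<forall>k\<in>{1..num_veh N t}.
        route N t k \<noteq> [] \<and> set (route N t k) \<subseteq> links N \<and>
        start_pos N t k \<in> {0..1} \<and> end_pos N t k \<in> {0..1} \<and>
        (\<forall>r<length (route N t k). 0 \<le> frac_traversed N t k r) \<and>
        (\<exists>r<length (route N t k). 0 < frac_traversed N t k r))"

text \<open>
  \<open>trans_q \<theta> i j\<close> is \<open>q\<^sub>i\<^sub>,\<^sub>j\<close> and is only meaningful for \<open>j \<le> deg N i\<close>; the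
  parameters \<open>p\<^sub>i\<^sub>,\<^sub>j\<close> are always \<open>1 - trans_q \<theta> i j\<close>. In \<open>tt_mean \<theta> i s\<close> and
  \<open>tt_sd \<theta> i s\<close> the argument \<open>s\<close> is the congestion state (\<open>True\<close> = congested).
\<close>

record 'i params =
  trans_q :: "'i \<Rightarrow> nat \<Rightarrow> real"
  tt_mean :: "'i \<Rightarrow> bool \<Rightarrow> real"
  tt_sd :: "'i \<Rightarrow> bool \<Rightarrow> real"

definition valid_q :: "'i network \<Rightarrow> ('i \<Rightarrow> nat \<Rightarrow> real) \<Rightarrow> bool" where
  "valid_q N q \<longleftrightarrow> (\<forall>i\<in>links N. \<forall>j\<in>{0..deg N i}. q i j \<in> {0..1})"

definition valid_sd :: "'i network \<Rightarrow> ('i \<Rightarrow> bool \<Rightarrow> real) \<Rightarrow> bool" where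
  "valid_sd N \<sigma> \<longleftrightarrow> (\<forall>i\<in>links N. \<forall>s. 0 < \<sigma> i s)"

definition valid_params :: "'i network \<Rightarrow> 'i params \<Rightarrow> bool" where
  "valid_params N \<theta> \<longleftrightarrow> valid_q N (trans_q \<theta>) \<and> valid_sd N (tt_sd \<theta>)"

text \<open>
  A hidden configuration \<open>(s, b)\<close> consists of the link states \<open>s (i, t)\<close> for \<open>t \<in> {0..T}\<close>,
  all uncongested at time 0, and the auxiliary variables \<open>b (i, t, j)\<close> for \<open>t \<in> {0..T - 1}\<close>
  and \<open>j \<in> {0..deg N i}\<close>. Extensionality makes the set of configurations finite.
\<close>

type_synonym 'i hidden = "('i \<times> nat \<Rightarrow> bool) \<times> ('i \<times> nat \<times> nat \<Rightarrow> bool)"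

definition hidden_configs :: "'i network \<Rightarrow> 'i hidden set" where
  "hidden_configs N =
     {s \<in> (links N \<times> {0..horizon N}) \<rightarrow>\<^sub>E UNIV. \<forall>i\<in>links N. \<not> s (i, 0)} \<times>
     ((SIGMA i:links N. {0..<horizon N} \<times> {0..deg N i}) \<rightarrow>\<^sub>E UNIV)"

definition eta :: "'i network \<Rightarrow> 'i hidden \<Rightarrow> 'i \<Rightarrow> nat \<Rightarrow> nat \<Rightarrow> bool" where
  "eta N h i t j = fst h (nbrs N i ! (j - 1), t)"

definition eta_bar :: "'i hidden \<Rightarrow> 'i \<Rightarrow> nat \<Rightarrow> nat \<Rightarrow> bool" where
  "eta_bar h i t j = snd h (i, t, j)"

definition trans_factor ::
  "'i network \<Rightarrow> 'i params \<Rightarrow> 'i \<Rightarrow> (nat \<Rightarrow> bool) \<Rightarrow> (nat \<Rightarrow> bool) \<Rightarrow> bool \<Rightarrow> real" where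
  "trans_factor N \<theta> i e b s =
     (if \<forall>j\<in>{1..deg N i}. b j \<longrightarrow> e j then
        trans_q \<theta> i 0 ^ of_bool (\<not> b 0) * (1 - trans_q \<theta> i 0) ^ of_bool (b 0) *
        of_bool ((\<exists>j\<in>{0..deg N i}. b j) = s) *
        (\<Prod>j\<in>{1..deg N i}.
           trans_q \<theta> i j ^ of_bool (e j \<and> \<not> b j) * (1 - trans_q \<theta> i j) ^ of_bool (e j \<and> b j))
      else 0)"

text \<open>
  Density at \<open>x\<close> of the sum of the independent normal travel times along the route of vehicle
  \<open>k\<close>, each scaled by the traversed fraction, given the link states \<open>s\<close> at time \<open>t\<close>.
  A link occurring repeatedly on a route contributes an independent travel time per traversal.
\<close>

definition obs_density ::
  "'i network \<Rightarrow> 'i params \<Rightarrow> nat \<Rightarrow> nat \<Rightarrow> ('i \<Rightarrow> bool) \<Rightarrow> real \<Rightarrow> real" where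
  "obs_density N \<theta> t k s x =
     (let L = route N t k; w = frac_traversed N t k in
      normal_density
        (\<Sum>r<length L. w r * tt_mean \<theta> (L ! r) (s (L ! r)))
        (sqrt (\<Sum>r<length L. (w r * tt_sd \<theta> (L ! r) (s (L ! r)))\<^sup>2))
        x)"

definition complete_likelihood ::
  "'i network \<Rightarrow> (nat \<Rightarrow> nat \<Rightarrow> real) \<Rightarrow> 'i params \<Rightarrow> 'i hidden \<Rightarrow> real" where
  "complete_likelihood N y \<theta> h =
     (\<Prod>t\<in>{1..horizon N}. \<Prod>i\<in>links N.
        trans_factor N \<theta> i (eta N h i (t - 1)) (eta_bar h i (t - 1)) (fst h (i, t))) *
     (\<Prod>t\<in>{1..horizon N}. \<Prod>k\<in>{1..num_veh N t}.
        obs_density N \<theta> t k (\<lambda>i. fst h (i, t)) (y t k))"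

definition obs_likelihood ::
  "'i network \<Rightarrow> (nat \<Rightarrow> nat \<Rightarrow> real) \<Rightarrow> 'i params \<Rightarrow> real" where
  "obs_likelihood N y \<theta> = (\<Sum>h\<in>hidden_configs N. complete_likelihood N y \<theta> h)"

definition posterior ::
  "'i network \<Rightarrow> (nat \<Rightarrow> nat \<Rightarrow> real) \<Rightarrow> 'i params \<Rightarrow> 'i hidden \<Rightarrow> real" where
  "posterior N y \<theta> h = complete_likelihood N y \<theta> h / obs_likelihood N y \<theta>"

definition posterior_prob ::
  "'i network \<Rightarrow> (nat \<Rightarrow> nat \<Rightarrow> real) \<Rightarrow> 'i params \<Rightarrow> ('i hidden \<Rightarrow> bool) \<Rightarrow> real" where
  "posterior_prob N y \<theta> E = (\<Sum>h | h \<in> hidden_configs N \<and> E h. posterior N y \<theta> h)"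

text \<open>
  The logarithm on the nonnegative reals must take the value \<open>-\<infinity>\<close> at 0 (the real \<open>ln\<close> has
  \<open>ln 0 = 0\<close>, which would distort the maximization). The convention \<open>0 ln 0 = 0\<close> is then
  the multiplication of extended reals.
\<close>

definition ext_ln :: "real \<Rightarrow> ereal" where
  "ext_ln x = (if x = 0 then -\<infinity> else ereal (ln x))"

definition Q_fun ::
  "'i network \<Rightarrow> (nat \<Rightarrow> nat \<Rightarrow> real) \<Rightarrow> 'i params \<Rightarrow> 'i params \<Rightarrow> ereal" where
  "Q_fun N y \<theta> \<theta>' =
     (\<Sum>h\<in>hidden_configs N. ereal (posterior N y \<theta>' h) * ext_ln (complete_likelihood N y \<theta> h))"

text \<open>
  The transition part of the M-step: \<open>q\<close> maximizes \<open>Q\<close> over all admissible transition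
  parameters, the travel-time parameters being held at \<open>\<mu>\<close>, \<open>\<sigma>\<close>.
\<close>

definition M_step_q ::
  "'i network \<Rightarrow> (nat \<Rightarrow> nat \<Rightarrow> real) \<Rightarrow> 'i params \<Rightarrow> ('i \<Rightarrow> bool \<Rightarrow> real) \<Rightarrow>
   ('i \<Rightarrow> bool \<Rightarrow> real) \<Rightarrow> ('i \<Rightarrow> nat \<Rightarrow> real) \<Rightarrow> bool" where
  "M_step_q N y \<theta>' \<mu> \<sigma> q \<longleftrightarrow>
     is_arg_max (\<lambda>q. Q_fun N y \<lparr>trans_q = q, tt_mean = \<mu>, tt_sd = \<sigma>\<rparr> \<theta>') (valid_q N) q"

end

theory Submission
  imports Defs
begin

text \<open>
  On configurations of positive posterior weight the indicator constraints hold, so the complete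
  likelihood is a positive constant times a product over \<open>(i, j)\<close> of Bernoulli likelihoods
  \<open>q ^ a * (1 - q) ^ b\<close>. Hence \<open>Q\<close> is a constant plus a sum of terms
  \<open>A ln q + B ln (1 - q)\<close>, where \<open>A\<close> and \<open>B\<close> are the expected counts, and each
  term is maximized separately, by Gibbs' inequality uniquely so at \<open>q = A / (A + B)\<close>
  unless \<open>A = B = 0\<close>.
  The time step \<open>t = 1\<close> contributes nothing for \<open>j \<ge> 1\<close> because no link is congested at
  time 0.
\<close>

section \<open>Gibbs' inequality for a single Bernoulli parameter\<close>

lemma ln_less_minus_one:
  fixes x :: real
  assumes "0 < x" "x \<noteq> 1"
  shows "ln x < x - 1"
  using assms ln_le_minus_one ln_eq_minus_one by (metis order_less_le)

text \<open>With \<open>s = A + B\<close>, the bound \<open>ln x < x - 1\<close> at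
  \<open>q / r\<close> and at \<open>(1 - q) / (1 - r)\<close> yields the error terms
  \<open>s * (q - r)\<close> and \<open>s * (r - q)\<close>, which cancel. The two implications on
  \<open>q\<close> exclude the boundary points where the convention \<open>ln 0 = 0\<close> would
  replace the true value minus infinity.\<close>

lemma bernoulli_cross_entropy_le:
  fixes A B q :: real
  assumes "0 \<le> A" "0 \<le> B" "0 \<le> q" "q \<le> 1"
    and "A > 0 \<Longrightarrow> q > 0" "B > 0 \<Longrightarrow> q < 1"
  defines "r \<equiv> A / (A + B)"
  shows "A * ln q + B * ln (1 - q) \<le> A * ln r + B * ln (1 - r)"
    and "A + B \<noteq> 0 \<Longrightarrow> q \<noteq> r \<Longrightarrow> A * ln q + B * ln (1 - q) < A * ln r + B * ln (1 - r)"
proof -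
  have strict: "A * ln q + B * ln (1 - q) < A * ln r + B * ln (1 - r)"
    if "A + B \<noteq> 0" "q \<noteq> r"
  proof -
    define s where "s = A + B"
    have s: "s > 0" and A: "A = s * r" and B: "B = s * (1 - r)"
      using that assms(1,2) by (auto simp: s_def r_def field_simps)
    have r: "0 \<le> r" "r \<le> 1"
      using s assms(1,2) by (auto simp: r_def s_def)
    have 1: "A * ln q - A * ln r < s * (q - r)" if "r > 0"
    proof -
      have q: "q > 0" using that s A assms(5) by simp
      have "ln (q / r) < q / r - 1"
        using q that \<open>q \<noteq> r\<close> by (intro ln_less_minus_one) auto
      hence "A * ln (q / r) < A * (q / r - 1)"
        using s that A by simp
      also have "\<dots> = s * (q - r)"
        using that by (simp add: A field_simps)
      finally show ?thesis using q that by (simp add: ln_div algebra_simps)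
    qed
    have 2: "B * ln (1 - q) - B * ln (1 - r) < s * (r - q)" if "r < 1"
    proof -
      have q: "q < 1" using that s B assms(6) by simp
      have "ln ((1 - q) / (1 - r)) < (1 - q) / (1 - r) - 1"
        using q that \<open>q \<noteq> r\<close> by (intro ln_less_minus_one) auto
      hence "B * ln ((1 - q) / (1 - r)) < B * ((1 - q) / (1 - r) - 1)"
        using s that B by simp
      also have "\<dots> = s * (r - q)"
        using that by (simp add: B field_simps)
      finally show ?thesis using q that by (simp add: ln_div algebra_simps)
    qed
    \<comment> \<open>At an endpoint only one of the two bounds applies; the other term vanishes
      because \<open>A = 0\<close> or \<open>B = 0\<close>, and the remaining error term has the
      right sign since \<open>q\<close> lies in the unit interval. Inside each case the number names
      the case assumption and shadows the bound of that number.\<close>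
    consider "r = 0" | "r = 1" | "0 < r" "r < 1" using r by linarith
    thus ?thesis
    proof cases
      case 1
      have "s * (r - q) \<le> 0" using 1 s assms(3) by (simp add: mult_le_0_iff)
      with 1 2 A show ?thesis by simp
    next
      case 2
      have "s * (q - r) \<le> 0" using 2 s assms(4) by (simp add: mult_le_0_iff)
      with 1 2 B show ?thesis by simp
    next
      case 3
      have "s * (q - r) + s * (r - q) = 0" by (simp add: algebra_simps)
      with 1 2 3 show ?thesis by linarith
    qed
  qed
  thus "A + B \<noteq> 0 \<Longrightarrow> q \<noteq> r \<Longrightarrow> A * ln q + B * ln (1 - q) < A * ln r + B * ln (1 - r)" .
  show "A * ln q + B * ln (1 - q) \<le> A * ln r + B * ln (1 - r)"
  proof (cases "A + B \<noteq> 0 \<and> q \<noteq> r")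
    case True
    thus ?thesis using strict by simp
  next
    case False
    hence "A = 0 \<and> B = 0 \<or> q = r" using assms(1,2) by auto
    thus ?thesis by auto
  qed
qed

section \<open>Weighted maximum likelihood for products of Bernoulli factors\<close>

text \<open>Abstract form of the M-step: \<open>H\<close> stands for the hidden configurations,
  \<open>K\<close> for the parameter indices, \<open>w\<close> for the posterior, \<open>C\<close>
  for the part of the likelihood free of \<open>q\<close>, and \<open>a\<close>, \<open>b\<close>
  for the exponents of \<open>q k\<close> and \<open>1 - q k\<close>.\<close>

locale bernoulli_mstep =
  fixes H :: "'h set" and K :: "'k set" and w C :: "'h \<Rightarrow> real" and a b :: "'h \<Rightarrow> 'k \<Rightarrow> nat"
  assumes finite_H: "finite H" and finite_K: "finite K"
    and w_nonneg: "h \<in> H \<Longrightarrow> 0 \<le> w h"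
    and C_pos: "h \<in> H \<Longrightarrow> 0 < w h \<Longrightarrow> 0 < C h"
begin

definition lik :: "('k \<Rightarrow> real) \<Rightarrow> 'h \<Rightarrow> real" where
  "lik q h = C h * (\<Prod>k\<in>K. q k ^ a h k * (1 - q k) ^ b h k)"

definition Q :: "('k \<Rightarrow> real) \<Rightarrow> ereal" where
  "Q q = (\<Sum>h\<in>H. ereal (w h) * ext_ln (lik q h))"

definition A :: "'k \<Rightarrow> real" where "A k = (\<Sum>h\<in>H. w h * real (a h k))"

definition B :: "'k \<Rightarrow> real" where "B k = (\<Sum>h\<in>H. w h * real (b h k))"

definition opt :: "'k \<Rightarrow> real" where "opt k = A k / (A k + B k)"

definition admissible :: "('k \<Rightarrow> real) \<Rightarrow> bool" where
  "admissible q \<longleftrightarrow> (\<forall>k\<in>K. 0 \<le> q k \<and> q k \<le> 1)"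

text \<open>For admissible \<open>q\<close> this characterizes finiteness of \<open>Q q\<close>: no
  configuration of positive weight gets likelihood 0.\<close>

definition nondegenerate :: "('k \<Rightarrow> real) \<Rightarrow> bool" where
  "nondegenerate q \<longleftrightarrow> (\<forall>k\<in>K. (A k > 0 \<longrightarrow> q k > 0) \<and> (B k > 0 \<longrightarrow> q k < 1))"

lemma A_nonneg: "0 \<le> A k" and B_nonneg: "0 \<le> B k"
  using w_nonneg by (auto simp: A_def B_def intro!: sum_nonneg)

text \<open>Links the aggregate counts to single configurations: a sum of nonnegative terms is
  positive iff some term is.\<close>

lemma A_pos_iff: "0 < A k \<longleftrightarrow> (\<exists>h\<in>H. 0 < w h \<and> 0 < a h k)"
  and B_pos_iff: "0 < B k \<longleftrightarrow> (\<exists>h\<in>H. 0 < w h \<and> 0 < b h k)"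
proof -
  have *: "0 < (\<Sum>h\<in>H. w h * real (c h)) \<longleftrightarrow> (\<exists>h\<in>H. 0 < w h \<and> 0 < c h)" for c :: "'h \<Rightarrow> nat"
  proof -
    have "0 < (\<Sum>h\<in>H. w h * real (c h)) \<longleftrightarrow> (\<Sum>h\<in>H. w h * real (c h)) \<noteq> 0"
      using sum_nonneg[of H "\<lambda>h. w h * real (c h)"] w_nonneg by (simp add: order_less_le)
    also have "\<dots> \<longleftrightarrow> (\<exists>h\<in>H. w h * real (c h) \<noteq> 0)"
      using sum_nonneg_eq_0_iff[OF finite_H, of "\<lambda>h. w h * real (c h)"] w_nonneg by simp
    also have "\<dots> \<longleftrightarrow> (\<exists>h\<in>H. 0 < w h \<and> 0 < c h)"
    proof (intro bex_cong refl)
      show "w h * real (c h) \<noteq> 0 \<longleftrightarrow> 0 < w h \<and> 0 < c h" if "h \<in> H" for h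
        using w_nonneg[OF that] by auto
    qed
    finally show ?thesis .
  qed
  show "0 < A k \<longleftrightarrow> (\<exists>h\<in>H. 0 < w h \<and> 0 < a h k)" "0 < B k \<longleftrightarrow> (\<exists>h\<in>H. 0 < w h \<and> 0 < b h k)"
    unfolding A_def B_def by (rule *)+
qed

lemma admissible_opt: "admissible opt"
  unfolding admissible_def opt_def
proof (intro ballI conjI)
  fix k
  show "0 \<le> A k / (A k + B k)" "A k / (A k + B k) \<le> 1"
    using A_nonneg[of k] B_nonneg[of k] by (auto simp: divide_le_eq_1)
qed

lemma nondegenerate_opt: "nondegenerate opt"
  unfolding nondegenerate_def opt_def
proof (intro ballI conjI impI)
  fix k
  show "0 < A k / (A k + B k)" if "0 < A k"
    using that B_nonneg[of k] by simp
  show "A k / (A k + B k) < 1" if "0 < B k"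
    using that A_nonneg[of k] by simp
qed

text \<open>A positive exponent at a configuration of positive weight makes the expected count
  positive, so nondegeneracy keeps the base positive; a zero exponent gives the power 1.\<close>

lemma factor_pos:
  assumes "nondegenerate q" "h \<in> H" "0 < w h" "k \<in> K"
  shows "0 < q k ^ a h k" "0 < (1 - q k) ^ b h k"
proof -
  have "0 < a h k \<Longrightarrow> 0 < q k" "0 < b h k \<Longrightarrow> q k < 1"
    using assms A_pos_iff[of k] B_pos_iff[of k] by (auto simp: nondegenerate_def)
  thus "0 < q k ^ a h k" "0 < (1 - q k) ^ b h k"
    by (cases "a h k"; cases "b h k"; simp)+
qed

lemma ln_lik:
  assumes "admissible q" "nondegenerate q" "h \<in> H" "0 < w h"
  shows "0 < lik q h"
    and "ln (lik q h) = ln (C h) + (\<Sum>k\<in>K. real (a h k) * ln (q k) + real (b h k) * ln (1 - q k))"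
proof -
  have pos: "0 < q k ^ a h k * (1 - q k) ^ b h k" if "k \<in> K" for k
    using factor_pos[OF assms(2-4) that] by simp
  \<comment> \<open>The base may be 0 only when \<open>n = 0\<close>; then both sides are 0.\<close>
  have ln_pow: "ln (x ^ n) = real n * ln x" if "0 < x ^ n" "0 \<le> x" for x :: real and n
    using that by (cases "n = 0"; cases "x = 0") (simp_all add: ln_realpow)
  have "ln (q k ^ a h k * (1 - q k) ^ b h k) = real (a h k) * ln (q k) + real (b h k) * ln (1 - q k)"
    if "k \<in> K" for k
    using factor_pos[OF assms(2-4) that] assms(1) that
    by (subst ln_mult) (auto simp: admissible_def ln_pow)
  moreover show "0 < lik q h"
    unfolding lik_def using C_pos[OF assms(3,4)] prod_pos[of K, OF pos] by (rule mult_pos_pos)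
  moreover have "ln (lik q h) = ln (C h) + ln (\<Prod>k\<in>K. q k ^ a h k * (1 - q k) ^ b h k)"
    unfolding lik_def using C_pos[OF assms(3,4)] prod_pos[of K, OF pos] by (intro ln_mult_pos)
  moreover have "\<dots> = ln (C h) + (\<Sum>k\<in>K. ln (q k ^ a h k * (1 - q k) ^ b h k))"
    using ln_prod[OF finite_K pos[THEN less_imp_neq, symmetric]] by simp
  ultimately show "ln (lik q h) =
      ln (C h) + (\<Sum>k\<in>K. real (a h k) * ln (q k) + real (b h k) * ln (1 - q k))"
    by simp
qed

text \<open>Every term is finite, so the extended sum is a real one, and exchanging the sums over
  \<open>H\<close> and \<open>K\<close> collects the exponents into the expected counts. Terms of
  weight 0 drop out because \<open>0 * -\<infinity> = 0\<close> in \<open>ereal\<close>.\<close>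

lemma Q_nondegenerate:
  assumes "admissible q" "nondegenerate q"
  shows "Q q = ereal ((\<Sum>h\<in>H. w h * ln (C h)) + (\<Sum>k\<in>K. A k * ln (q k) + B k * ln (1 - q k)))"
proof -
  let ?g = "\<lambda>h. w h * (ln (C h) + (\<Sum>k\<in>K. real (a h k) * ln (q k) + real (b h k) * ln (1 - q k)))"
  have "ereal (w h) * ext_ln (lik q h) = ereal (?g h)" if "h \<in> H" for h
  proof (cases "w h = 0")
    case False
    hence "0 < w h" using w_nonneg[OF that] by simp
    from ln_lik[OF assms that this] show ?thesis by (simp add: ext_ln_def)
  qed (simp flip: zero_ereal_def)
  hence "Q q = (\<Sum>h\<in>H. ereal (?g h))" unfolding Q_def by (rule sum.cong[OF refl])
  also have "\<dots> = ereal (\<Sum>h\<in>H. ?g h)" by simp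
  also have "(\<Sum>h\<in>H. ?g h) = (\<Sum>h\<in>H. w h * ln (C h)) +
      (\<Sum>h\<in>H. \<Sum>k\<in>K. w h * real (a h k) * ln (q k) + w h * real (b h k) * ln (1 - q k))"
    by (simp add: algebra_simps sum.distrib sum_distrib_left)
  also have "(\<Sum>h\<in>H. \<Sum>k\<in>K. w h * real (a h k) * ln (q k) + w h * real (b h k) * ln (1 - q k)) =
      (\<Sum>k\<in>K. A k * ln (q k) + B k * ln (1 - q k))"
    by (subst sum.swap) (simp add: A_def B_def sum.distrib sum_distrib_right)
  finally show ?thesis .
qed

text \<open>A violated condition yields, by positivity of an expected count, a configuration of
  positive weight and likelihood 0, whose term is \<open>-\<infinity>\<close>.\<close>

lemma Q_degenerate:
  assumes "admissible q" "\<not> nondegenerate q"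
  shows "Q q = -\<infinity>"
proof -
  let ?g = "\<lambda>h. ereal (w h) * ext_ln (lik q h)"
  obtain k where k: "k \<in> K" "0 < A k \<and> q k = 0 \<or> 0 < B k \<and> q k = 1"
    using assms by (force simp: admissible_def nondegenerate_def)
  then obtain h where h: "h \<in> H" "0 < w h" "q k ^ a h k * (1 - q k) ^ b h k = 0"
    using A_pos_iff[of k] B_pos_iff[of k] by auto
  have "lik q h = 0"
    using h(3) k(1) finite_K by (auto simp: lik_def)
  hence g_h: "?g h = -\<infinity>" using h by (simp add: ext_ln_def)
  \<comment> \<open>In \<open>ereal\<close>, adding \<open>\<infinity>\<close> to
    \<open>-\<infinity>\<close> gives \<open>\<infinity>\<close>, so that value must be ruled out
    for the remaining terms.\<close>
  have "?g h' \<noteq> \<infinity>" if "h' \<in> H" for h'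
    using w_nonneg[OF that] by (auto simp: ext_ln_def)
  hence "sum ?g (H - {h}) \<noteq> \<infinity>" by (simp add: sum_Pinfty)
  thus ?thesis
    unfolding Q_def sum.remove[OF finite_H h(1)] g_h by simp
qed

text \<open>The objective separates over \<open>K\<close>, so one strict coordinate suffices.
  Coordinates with both counts 0 do not influence \<open>Q\<close> and are excluded.\<close>

lemma Q_less_opt:
  assumes "admissible q" "k \<in> K" "A k + B k \<noteq> 0" "q k \<noteq> opt k"
  shows "Q q < Q opt"
proof (cases "nondegenerate q")
  case True
  note le = bernoulli_cross_entropy_le[of "A k" "B k" "q k" for k, folded opt_def]
  have "(\<Sum>k\<in>K. A k * ln (q k) + B k * ln (1 - q k)) <
      (\<Sum>k\<in>K. A k * ln (opt k) + B k * ln (1 - opt k))"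
  proof (rule sum_strict_mono_ex1[OF finite_K])
    show "\<forall>k\<in>K. A k * ln (q k) + B k * ln (1 - q k) \<le> A k * ln (opt k) + B k * ln (1 - opt k)"
      using True assms(1) A_nonneg B_nonneg
      by (intro ballI le) (auto simp: admissible_def nondegenerate_def)
    have "A k * ln (q k) + B k * ln (1 - q k) < A k * ln (opt k) + B k * ln (1 - opt k)"
      using True assms A_nonneg B_nonneg
      by (intro le) (auto simp: admissible_def nondegenerate_def)
    thus "\<exists>k\<in>K. A k * ln (q k) + B k * ln (1 - q k) < A k * ln (opt k) + B k * ln (1 - opt k)"
      using assms(2) by blast
  qed
  thus ?thesis
    using Q_nondegenerate[OF assms(1) True] Q_nondegenerate[OF admissible_opt nondegenerate_opt] by simp
next
  case False
  thus ?thesis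
    using Q_degenerate[OF assms(1)] Q_nondegenerate[OF admissible_opt nondegenerate_opt] by simp
qed

lemma Q_le_opt:
  assumes "admissible q"
  shows "Q q \<le> Q opt"
proof (cases "nondegenerate q")
  case True
  have "(\<Sum>k\<in>K. A k * ln (q k) + B k * ln (1 - q k)) \<le>
      (\<Sum>k\<in>K. A k * ln (opt k) + B k * ln (1 - opt k))"
    using True assms A_nonneg B_nonneg unfolding opt_def
    by (intro sum_mono bernoulli_cross_entropy_le) (auto simp: admissible_def nondegenerate_def)
  thus ?thesis
    using Q_nondegenerate[OF assms True] Q_nondegenerate[OF admissible_opt nondegenerate_opt] by simp
qed (simp add: Q_degenerate assms)

end


section \<open>Factorization of the complete likelihood into Bernoulli factors\<close>

text \<open>Treats \<open>j = 0\<close> as a neighbor that is always congested, so that all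
  parameters of a link enter one product. The disjunct is essential: by truncated subtraction
  \<open>eta\<close> at \<open>j = 0\<close> would read the first neighbor.\<close>

definition active :: "'i network \<Rightarrow> 'i hidden \<Rightarrow> 'i \<Rightarrow> nat \<Rightarrow> nat \<Rightarrow> bool" where
  "active N h i t j \<longleftrightarrow> j = 0 \<or> eta N h i t j"

text \<open>The exponent of the parameter \<open>q\<close> with index \<open>(i, j)\<close> in the
  complete likelihood; \<open>num_on\<close> is the exponent of its complement.\<close>

definition num_off :: "'i network \<Rightarrow> 'i hidden \<Rightarrow> 'i \<times> nat \<Rightarrow> nat" where
  "num_off N h = (\<lambda>(i, j). \<Sum>t=1..horizon N.
     of_bool (active N h i (t - 1) j \<and> \<not> eta_bar h i (t - 1) j))"

definition num_on :: "'i network \<Rightarrow> 'i hidden \<Rightarrow> 'i \<times> nat \<Rightarrow> nat" where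
  "num_on N h = (\<lambda>(i, j). \<Sum>t=1..horizon N.
     of_bool (active N h i (t - 1) j \<and> eta_bar h i (t - 1) j))"

abbreviation param_indices :: "'i network \<Rightarrow> ('i \<times> nat) set" where
  "param_indices N \<equiv> SIGMA i:links N. {0..deg N i}"

definition obs_factor ::
  "'i network \<Rightarrow> (nat \<Rightarrow> nat \<Rightarrow> real) \<Rightarrow> 'i params \<Rightarrow> 'i hidden \<Rightarrow> real" where
  "obs_factor N y \<theta> h = (\<Prod>t\<in>{1..horizon N}. \<Prod>k\<in>{1..num_veh N t}.
     obs_density N \<theta> t k (\<lambda>i. fst h (i, t)) (y t k))"

lemma trans_factor_nonneg:
  assumes "valid_q N (trans_q \<theta>)" "i \<in> links N"
  shows "0 \<le> trans_factor N \<theta> i e b s"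
  using assms unfolding trans_factor_def valid_q_def
  by (auto intro!: mult_nonneg_nonneg prod_nonneg zero_le_power)

lemma complete_likelihood_nonneg:
  assumes "valid_q N (trans_q \<theta>)"
  shows "0 \<le> complete_likelihood N y \<theta> h"
  unfolding complete_likelihood_def obs_density_def Let_def
  using trans_factor_nonneg[OF assms] by (intro mult_nonneg_nonneg prod_nonneg) auto

text \<open>The support conditions do not mention the parameters. Being nonzero at one
  \<open>\<theta>'\<close> therefore forces them, and they may be dropped from the factor at any
  other \<open>\<theta>\<close>.\<close>

lemma trans_factor_eq_prod:
  assumes "trans_factor N \<theta>' i (eta N h i t) b s \<noteq> 0"
  shows "trans_factor N \<theta> i (eta N h i t) b s =
    (\<Prod>j\<in>{0..deg N i}. trans_q \<theta> i j ^ of_bool (active N h i t j \<and> \<not> b j) *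
       (1 - trans_q \<theta> i j) ^ of_bool (active N h i t j \<and> b j))"
proof -
  have 1: "\<forall>j\<in>{1..deg N i}. b j \<longrightarrow> eta N h i t j"
    using assms unfolding trans_factor_def by (rule contrapos_np) (simp only: if_False)
  moreover have 2: "(\<exists>j\<in>{0..deg N i}. b j) = s"
    using assms unfolding trans_factor_def if_P[OF 1] by (simp only: mult_eq_0_iff of_bool_eq_0_iff) blast
  have 3: "{0..deg N i} = insert 0 {1..deg N i}" by auto
  have "(\<Prod>j\<in>{1..deg N i}. trans_q \<theta> i j ^ of_bool (active N h i t j \<and> \<not> b j) *
       (1 - trans_q \<theta> i j) ^ of_bool (active N h i t j \<and> b j)) =
     (\<Prod>j\<in>{1..deg N i}. trans_q \<theta> i j ^ of_bool (eta N h i t j \<and> \<not> b j) *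
       (1 - trans_q \<theta> i j) ^ of_bool (eta N h i t j \<and> b j))"
    by (rule prod.cong) (auto simp: active_def)
  moreover have "(\<Prod>j\<in>{0..deg N i}. trans_q \<theta> i j ^ of_bool (active N h i t j \<and> \<not> b j) *
       (1 - trans_q \<theta> i j) ^ of_bool (active N h i t j \<and> b j)) =
     trans_q \<theta> i 0 ^ of_bool (\<not> b 0) * (1 - trans_q \<theta> i 0) ^ of_bool (b 0) *
     (\<Prod>j\<in>{1..deg N i}. trans_q \<theta> i j ^ of_bool (active N h i t j \<and> \<not> b j) *
       (1 - trans_q \<theta> i j) ^ of_bool (active N h i t j \<and> b j))"
    unfolding 3 by (subst prod.insert) (simp_all add: active_def)
  ultimately show ?thesis
    unfolding trans_factor_def if_P[OF 1] 2 by simp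
qed

text \<open>Moving the product over time innermost turns each run of 0/1 exponents into a count.
  Applied with \<open>\<theta>'\<close> the current estimate and \<open>\<theta>\<close> the
  candidate.\<close>

lemma complete_likelihood_eq:
  assumes "finite (links N)" "complete_likelihood N y \<theta>' h \<noteq> 0"
  shows "complete_likelihood N y \<theta> h = obs_factor N y \<theta> h *
    (\<Prod>k\<in>param_indices N.
       case_prod (trans_q \<theta>) k ^ num_off N h k * (1 - case_prod (trans_q \<theta>) k) ^ num_on N h k)"
proof -
  let ?f = "\<lambda>t i j. trans_q \<theta> i j ^ of_bool (active N h i (t - 1) j \<and> \<not> eta_bar h i (t - 1) j) *
    (1 - trans_q \<theta> i j) ^ of_bool (active N h i (t - 1) j \<and> eta_bar h i (t - 1) j)"
  have nz: "trans_factor N \<theta>' i (eta N h i (t - 1)) (eta_bar h i (t - 1)) (fst h (i, t)) \<noteq> 0"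
    if "t \<in> {1..horizon N}" "i \<in> links N" for t i
    using assms that unfolding complete_likelihood_def by auto
  have "(\<Prod>t\<in>{1..horizon N}. \<Prod>i\<in>links N.
        trans_factor N \<theta> i (eta N h i (t - 1)) (eta_bar h i (t - 1)) (fst h (i, t))) =
      (\<Prod>t\<in>{1..horizon N}. \<Prod>i\<in>links N. \<Prod>j\<in>{0..deg N i}. ?f t i j)"
    using trans_factor_eq_prod[OF nz] by (intro prod.cong refl) auto
  also have "\<dots> = (\<Prod>t\<in>{1..horizon N}. \<Prod>(i, j)\<in>param_indices N. ?f t i j)"
    using assms(1) by (simp add: prod.Sigma)
  also have "\<dots> = (\<Prod>(i, j)\<in>param_indices N. \<Prod>t\<in>{1..horizon N}. ?f t i j)"
    unfolding case_prod_unfold by (rule prod.swap)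
  also have "\<dots> = (\<Prod>k\<in>param_indices N.
       case_prod (trans_q \<theta>) k ^ num_off N h k * (1 - case_prod (trans_q \<theta>) k) ^ num_on N h k)"
    by (intro prod.cong refl) (auto simp: num_off_def num_on_def power_sum prod.distrib simp del: sum_of_bool_eq)
  finally show ?thesis
    unfolding complete_likelihood_def obs_factor_def by (simp add: mult.commute)
qed

text \<open>Each vehicle covers a positive fraction of some link, whose standard deviation is
  positive, so the total variance is positive.\<close>

lemma obs_factor_pos:
  assumes "wf_network N" "valid_sd N (tt_sd \<theta>)"
  shows "0 < obs_factor N y \<theta> h"
proof -
  have "0 < obs_density N \<theta> t k s (y t k)" if tk: "t \<in> {1..horizon N}" "k \<in> {1..num_veh N t}" for t k s
  proof -
    let ?L = "route N t k" and ?w = "frac_traversed N t k"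
    have "\<forall>t\<in>{1..horizon N}. \<forall>k\<in>{1..num_veh N t}. set (route N t k) \<subseteq> links N \<and>
        (\<exists>r<length (route N t k). 0 < frac_traversed N t k r)"
      using assms(1) unfolding wf_network_def by simp
    hence wf: "set ?L \<subseteq> links N" "\<exists>r<length ?L. 0 < ?w r"
      using tk by blast+
    then obtain r where r: "r < length ?L" "0 < ?w r" by blast
    moreover from this have "0 < tt_sd \<theta> (?L ! r) (s (?L ! r))"
      using assms(2) wf(1) nth_mem unfolding valid_sd_def by blast
    ultimately have "0 < (\<Sum>r<length ?L. (?w r * tt_sd \<theta> (?L ! r) (s (?L ! r)))\<^sup>2)"
      by (intro sum_pos2[of _ r]) auto
    thus ?thesis
      unfolding obs_density_def Let_def by (intro normal_density_pos) simp
  qed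
  thus ?thesis unfolding obs_factor_def by (intro prod_pos) simp
qed

section \<open>Expected counts under the posterior\<close>

lemma finite_hidden_configs:
  fixes N :: "'i network"
  assumes "finite (links N)"
  shows "finite (hidden_configs N)"
proof -
  have "finite ((links N \<times> {0..horizon N}) \<rightarrow>\<^sub>E (UNIV :: bool set))"
    "finite ((SIGMA i:links N. {0..<horizon N} \<times> {0..deg N i}) \<rightarrow>\<^sub>E (UNIV :: bool set))"
    using assms by (auto intro!: finite_PiE)
  thus ?thesis unfolding hidden_configs_def by (auto intro: rev_finite_subset)
qed

text \<open>Linearity of expectation for a sum of indicators.\<close>

lemma expected_count:
  assumes "finite (hidden_configs N)"
  shows "(\<Sum>h\<in>hidden_configs N. posterior N y \<theta> h * real (\<Sum>t\<in>I. of_bool (E t h))) =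
    (\<Sum>t\<in>I. posterior_prob N y \<theta> (E t))"
proof -
  have "posterior_prob N y \<theta> (E t) = (\<Sum>h\<in>hidden_configs N. posterior N y \<theta> h * of_bool (E t h))" for t
    unfolding posterior_prob_def using assms by (intro sum.mono_neutral_cong_left) auto
  hence "(\<Sum>t\<in>I. posterior_prob N y \<theta> (E t)) =
      (\<Sum>h\<in>hidden_configs N. \<Sum>t\<in>I. posterior N y \<theta> h * of_bool (E t h))"
    by (simp only: sum.swap[of _ _ I])
  thus ?thesis
    by (simp add: sum_distrib_left del: sum_of_bool_eq sum_mult_of_bool_eq)
qed

lemma not_eta_0:
  assumes "wf_network N" "h \<in> hidden_configs N" "i \<in> links N" "j \<in> {1..deg N i}"
  shows "\<not> eta N h i 0 j"
proof -
  have "nbrs N i ! (j - 1) \<in> set (nbrs N i)" using assms(4) by (intro nth_mem) auto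
  hence "nbrs N i ! (j - 1) \<in> links N" using assms(1,3) unfolding wf_network_def by blast
  thus ?thesis using assms(2) unfolding hidden_configs_def eta_def by auto
qed

lemma sum_posterior:
  assumes "obs_likelihood N y \<theta> \<noteq> 0"
  shows "(\<Sum>h\<in>hidden_configs N. posterior N y \<theta> h) = 1"
  using assms unfolding posterior_def obs_likelihood_def by (simp flip: sum_divide_distrib)

lemma posterior_prob_False [simp]: "posterior_prob N y \<theta> (\<lambda>h. False) = 0"
  by (simp add: posterior_prob_def)

lemma posterior_prob_cong:
  assumes "\<And>h. h \<in> hidden_configs N \<Longrightarrow> E h = F h"
  shows "posterior_prob N y \<theta> E = posterior_prob N y \<theta> F"
  unfolding posterior_prob_def using assms by (intro sum.cong) auto


section \<open>Maximizers of the expected log-likelihood of the network\<close>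

theorem proposition1:
  fixes N :: "'i network"
    and y :: "nat \<Rightarrow> nat \<Rightarrow> real"
    and \<theta> :: "'i params"
    and \<mu> \<sigma> :: "'i \<Rightarrow> bool \<Rightarrow> real"
  assumes "wf_network N"
    and "horizon N \<ge> 2"
    and "valid_params N \<theta>"
    and "obs_likelihood N y \<theta> > 0"
    and "valid_sd N \<sigma>"
  shows "(\<exists>q. M_step_q N y \<theta> \<mu> \<sigma> q) \<and>
    (\<forall>q. M_step_q N y \<theta> \<mu> \<sigma> q \<longrightarrow>
      (\<forall>i\<in>links N. \<forall>j\<in>{1..deg N i}.
        let a = (\<Sum>t=2..horizon N.
                   posterior_prob N y \<theta> (\<lambda>h. eta N h i (t - 1) j \<and> \<not> eta_bar h i (t - 1) j));
            b = (\<Sum>t=2..horizon N.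
                   posterior_prob N y \<theta> (\<lambda>h. eta N h i (t - 1) j \<and> eta_bar h i (t - 1) j))
        in \<not> (a = 0 \<and> b = 0) \<longrightarrow> (\<exists>c>0. q i j = c * a \<and> 1 - q i j = c * b)) \<and>
      (\<forall>i\<in>links N.
        \<exists>c>0. q i 0 = c * (\<Sum>t=1..horizon N.
                     posterior_prob N y \<theta> (\<lambda>h. \<not> eta_bar h i (t - 1) 0)) \<and>
              1 - q i 0 = c * (\<Sum>t=1..horizon N.
                     posterior_prob N y \<theta> (\<lambda>h. eta_bar h i (t - 1) 0))))"
proof -
  define w where "w = posterior N y \<theta>"
  define \<theta>' where "\<theta>' q = \<lparr>trans_q = q, tt_mean = \<mu>, tt_sd = \<sigma>\<rparr>" for q
  have fin_links: "finite (links N)" using assms(1) by (simp add: wf_network_def)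
  note fin = finite_hidden_configs[OF fin_links]
  have w_nonneg: "0 \<le> w h" for h
    using assms(3,4) complete_likelihood_nonneg[of N \<theta> y h]
    by (simp add: w_def posterior_def valid_params_def)
  have C_pos: "0 < obs_factor N y (\<theta>' q) h" for q h
    using assms(1,5) by (intro obs_factor_pos) (simp_all add: \<theta>'_def)
  \<comment> \<open>The observation densities ignore \<open>trans_q\<close>, so
    \<open>undefined\<close> can serve as a fixed value and the locale receives a single
    \<open>C\<close>.\<close>
  have C_eq: "obs_factor N y (\<theta>' q) = obs_factor N y (\<theta>' undefined)" for q
    unfolding obs_factor_def obs_density_def \<theta>'_def by simp
  interpret bernoulli_mstep "hidden_configs N" "param_indices N" w
      "obs_factor N y (\<theta>' undefined)" "num_off N" "num_on N"
    using fin fin_links w_nonneg C_pos by unfold_locales auto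
  \<comment> \<open>The factorization is available only where the posterior is nonzero; elsewhere
    both terms are 0.\<close>
  have Q_eq: "Q_fun N y (\<theta>' q) \<theta> = Q (case_prod q)" for q
    unfolding Q_fun_def Q_def
  proof (rule sum.cong[OF refl])
    fix h
    show "ereal (posterior N y \<theta> h) * ext_ln (complete_likelihood N y (\<theta>' q) h) =
      ereal (w h) * ext_ln (lik (case_prod q) h)"
    proof (cases "w h = 0")
      case False
      hence "complete_likelihood N y \<theta> h \<noteq> 0" by (auto simp: w_def posterior_def)
      from complete_likelihood_eq[OF fin_links this, of "\<theta>' q"] show ?thesis
        by (simp add: w_def lik_def C_eq[of q]) (simp add: \<theta>'_def)
    qed (simp add: w_def flip: zero_ereal_def)
  qed
  have adm: "valid_q N q \<longleftrightarrow> admissible (case_prod q)" for q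
    by (auto simp: valid_q_def admissible_def)
  have mstep: "M_step_q N y \<theta> \<mu> \<sigma> q \<longleftrightarrow>
      is_arg_max (\<lambda>q. Q (case_prod q)) (\<lambda>q. admissible (case_prod q)) q" for q
    unfolding M_step_q_def adm[symmetric] Q_eq[symmetric] unfolding \<theta>'_def by (rule refl)
  have ex: "M_step_q N y \<theta> \<mu> \<sigma> (curry opt)"
    using admissible_opt Q_le_opt by (auto simp: mstep is_arg_max_def not_less)
  have uniq: "q i j = opt (i, j)"
    \<comment> \<open>Only coordinates with a nonzero total count are determined; a maximizer is
      arbitrary within the unit interval elsewhere.\<close>
    if "M_step_q N y \<theta> \<mu> \<sigma> q" "i \<in> links N" "j \<in> {0..deg N i}" "A (i, j) + B (i, j) \<noteq> 0" for q i j
  proof (rule ccontr)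
    assume "q i j \<noteq> opt (i, j)"
    hence "Q (case_prod q) < Q (case_prod (curry opt))"
      using that Q_less_opt[of "case_prod q" "(i, j)"] by (auto simp: mstep is_arg_max_def)
    thus False using that(1) admissible_opt
      unfolding mstep is_arg_max_def by (metis case_prod_curry)
  qed
  have scaled: "\<exists>c>0. q i j = c * A (i, j) \<and> 1 - q i j = c * B (i, j)"
    if "M_step_q N y \<theta> \<mu> \<sigma> q" "i \<in> links N" "j \<in> {0..deg N i}" "A (i, j) + B (i, j) \<noteq> 0" for q i j
  proof (intro exI[of _ "1 / (A (i, j) + B (i, j))"] conjI)
    show "0 < 1 / (A (i, j) + B (i, j))"
      using that(4) A_nonneg[of "(i, j)"] B_nonneg[of "(i, j)"] by simp
  qed (use uniq[OF that] that(4) in \<open>auto simp: opt_def field_simps\<close>)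
  have A_eq: "A (i, j) = (\<Sum>t=1..horizon N. posterior_prob N y \<theta>
      (\<lambda>h. active N h i (t - 1) j \<and> \<not> eta_bar h i (t - 1) j))"
    and B_eq: "B (i, j) = (\<Sum>t=1..horizon N. posterior_prob N y \<theta>
      (\<lambda>h. active N h i (t - 1) j \<and> eta_bar h i (t - 1) j))" for i j
    unfolding A_def B_def unfolding w_def num_off_def num_on_def case_prod_conv
    by (rule expected_count[OF fin])+
  have from_2: "(\<Sum>t=1..horizon N. posterior_prob N y \<theta> (\<lambda>h. active N h i (t - 1) j \<and> E t h)) =
      (\<Sum>t=2..horizon N. posterior_prob N y \<theta> (\<lambda>h. eta N h i (t - 1) j \<and> E t h))"
    if "i \<in> links N" "j \<in> {1..deg N i}" for i j E
  proof -
    \<comment> \<open>The term \<open>t = 1\<close> concerns states at time 0, all uncongested, so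
      the sum may start at 2.\<close>
    have "posterior_prob N y \<theta> (\<lambda>h. eta N h i 0 j \<and> E 1 h) = posterior_prob N y \<theta> (\<lambda>h. False)"
      using not_eta_0[OF assms(1) _ that] by (intro posterior_prob_cong) auto
    moreover have "{1..horizon N} = insert 1 {2..horizon N}" using assms(2) by auto
    ultimately show ?thesis using that by (simp add: active_def)
  qed
  \<comment> \<open>The index 0 is active at every step, so each step is counted exactly once as off
    or on; as the posterior has total mass 1, the normalizer is the positive number of steps and the
    formula for \<open>j = 0\<close> needs no proviso.\<close>
  have AB_0: "A (i, 0) + B (i, 0) = real (horizon N)" for i
  proof -
    have "num_off N h (i, 0) + num_on N h (i, 0) = horizon N" for h
    proof -
      have "num_off N h (i, 0) + num_on N h (i, 0) = (\<Sum>t=1..horizon N. 1)"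
        unfolding num_off_def num_on_def case_prod_conv sum.distrib[symmetric]
        by (intro sum.cong) (auto simp: active_def)
      thus ?thesis by simp
    qed
    hence "A (i, 0) + B (i, 0) = (\<Sum>h\<in>hidden_configs N. w h * real (horizon N))"
      unfolding A_def B_def sum.distrib[symmetric] distrib_left[symmetric] of_nat_add[symmetric]
      by simp
    thus ?thesis
      using sum_posterior[of N y \<theta>] assms(4) by (simp add: w_def flip: sum_distrib_right)
  qed
  show ?thesis
  proof (intro conjI allI impI ballI)
    show "\<exists>q. M_step_q N y \<theta> \<mu> \<sigma> q" using ex by blast
  next
    fix q i j
    assume q: "M_step_q N y \<theta> \<mu> \<sigma> q" and i: "i \<in> links N" and j: "j \<in> {1..deg N i}"
    have "\<not> (A (i, j) = 0 \<and> B (i, j) = 0) \<longrightarrow>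
        (\<exists>c>0. q i j = c * A (i, j) \<and> 1 - q i j = c * B (i, j))"
      \<comment> \<open>Nonnegativity of both counts turns "not both zero" into a nonzero
        sum.\<close>
      using scaled[OF q i, of j] j A_nonneg[of "(i, j)"] B_nonneg[of "(i, j)"]
      by (auto simp: add_nonneg_eq_0_iff)
    thus "let a = (\<Sum>t=2..horizon N.
                   posterior_prob N y \<theta> (\<lambda>h. eta N h i (t - 1) j \<and> \<not> eta_bar h i (t - 1) j));
            b = (\<Sum>t=2..horizon N.
                   posterior_prob N y \<theta> (\<lambda>h. eta N h i (t - 1) j \<and> eta_bar h i (t - 1) j))
        in \<not> (a = 0 \<and> b = 0) \<longrightarrow> (\<exists>c>0. q i j = c * a \<and> 1 - q i j = c * b)"
      unfolding Let_def A_eq B_eq from_2[OF i j] .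
  next
    fix q i
    assume q: "M_step_q N y \<theta> \<mu> \<sigma> q" and i: "i \<in> links N"
    have "\<exists>c>0. q i 0 = c * A (i, 0) \<and> 1 - q i 0 = c * B (i, 0)"
      using scaled[OF q i, of 0] AB_0[of i] assms(2) by simp
    thus "\<exists>c>0. q i 0 = c * (\<Sum>t=1..horizon N.
                     posterior_prob N y \<theta> (\<lambda>h. \<not> eta_bar h i (t - 1) 0)) \<and>
              1 - q i 0 = c * (\<Sum>t=1..horizon N.
                     posterior_prob N y \<theta> (\<lambda>h. eta_bar h i (t - 1) 0))"
      unfolding A_eq B_eq by (simp add: active_def)
  qed
qed

end
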